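(* Let $\ell\in\{1,2\}$, and let $A^{\ell\text{-loop}}(\lambda,\alpha)$ and $B^{\ell\text{-loop}}(\lambda,\alpha,L_R)$ be the truncated expansions defined in the context. Substitute $L_R=\sum_{i=-1}^{\ell-1}X_i\alpha^i$ into $B^{\ell\text{-loop}}$. Then the coefficients of $\alpha^r\lambda^{\{m_j\}}$ in $B^{\ell\text{-loop}}/K$ and $A^{\ell\text{-loop}}/K$ agree for all $0\le r\le \ell$, all $1\le j\le\ell$ and all assignments $\{m_j\}$, with $X_{-1},\dots,X_{\ell-1}$ independent of the kinematic invariants, if and only if $\partial X_i/\partial s_n=0$ for all $n=1,\dots,N$ and $i=-1,\dots,\ell-1$, and the following equations hold. (i) If $\ell=1$: for every assignment $\{m_1\}$, $$A_{01}^{\{m_1\}}-B_{111}^{\{m_1\}}X_{-1}-B_{212}^{\{m_1\}}X_{-1}^2=0,$$ $$A_{11}^{\{m_1\}}-B_{110}^{\{m_1\}}-B_{111}^{\{m_1\}}X_0-B_{211}^{\{m_1\}}X_{-1}-2B_{212}^{\{m_1\}}X_{-1}X_0=0.$$ (ii) If $\ell=2$: for $j=1,2$ and every assignment $\{m_j\}$, $$A_{0j}^{\{m_j\}}-B_{1j1}^{\{m_j\}}X_{-1}-B_{2j2}^{\{m_j\}}X_{-1}^2-B_{3j3}^{\{m_j\}}X_{-1}^3=0,$$ $$A_{1j}^{\{m_j\}}-B_{1j0}^{\{m_j\}}-B_{1j1}^{\{m_j\}}X_0-B_{2j1}^{\{m_j\}}X_{-1}-2B_{2j2}^{\{m_j\}}X_{-1}X_0-B_{3j2}^{\{m_j\}}X_{-1}^2-3B_{3j3}^{\{m_j\}}X_{-1}^2X_0=0,$$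 $$A_{2j}^{\{m_j\}}-B_{2j0}^{\{m_j\}}-B_{1j1}^{\{m_j\}}X_1-B_{2j1}^{\{m_j\}}X_0-B_{2j2}^{\{m_j\}}(X_0^2+2X_{-1}X_1)-B_{3j1}^{\{m_j\}}X_{-1}-2B_{3j2}^{\{m_j\}}X_{-1}X_0-3B_{3j3}^{\{m_j\}}(X_{-1}X_0^2+X_{-1}^2X_1)=0.$$
   Context: Fix $N\ge1$ kinematic invariants $s_1,\dots,s_N$ and mass scales $M_1,\dots,M_N$, and put $\lambda_n=s_n/M_n^2$. For $j\ge1$ an assignment $\{m_j\}=(m_{j1},\dots,m_{jN})$ is an $N$-tuple of nonnegative integers with $\sum_n m_{jn}=j$, and $\lambda^{\{m_j\}}:=\prod_n\lambda_n^{m_{jn}}$. A product such as $A_{ij}^{\{m_j\}}\lambda^{\{m_j\}}$ in a sum means summation over all assignments $\{m_j\}$. The full (formal) expansions of an amplitude in a renormalizable theory ($A$) and in a nonrenormalizable effective theory ($B$) are $$A(\lambda,\alpha)=K(\alpha)\Big(1+\sum_{j\ge1}A_{0j}^{\{m_j\}}\lambda^{\{m_j\}}+\sum_{i,j\ge1}A_{ij}^{\{m_j\}}\alpha^i\lambda^{\{m_j\}}\Big),$$ $$B(\lambda,\alpha,L_R)=K(\alpha)\Big(1+\sum_{i,j\ge1}\ \sum_{0\le k\le i}B_{ijk}^{\{m_j\}}\alpha^i\lambda^{\{m_j\}}L_R^k\Big),$$ with common prefactor $K(\alpha)$. Here $L_R=\ln\mu_R^2$ is the logarithm of the renormalization scale.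 The coefficients $A_{ij}^{\{m_j\}},B_{ijk}^{\{m_j\}}$ may themselves be functions of the $s_n$ (e.g. contain $\ln s_n$). In comparing coefficients, $\alpha$ and the $\lambda_n$ are treated as independent formal variables and $A_{ij}^{\{m_j\}},B_{ijk}^{\{m_j\}}$ as coefficients. $A^{\ell\text{-loop}}$ denotes $A$ restricted to terms with $i\le\ell$, $j\le\ell$. $B^{\ell\text{-loop}}$ denotes $B$ restricted to terms with $i\le\ell+1$, $j\le\ell$, $k\ge i-\ell$ (and $0\le k\le i$). After substitution of $L_R=\sum_{i=-1}^{\ell-1}X_i\alpha^i$, powers of $\alpha$ higher than $\ell$ are discarded. *)

theory Defs
  imports
    "HOL-Analysis.Analysis"
    "HOL-Computational_Algebra.Formal_Laurent_Series"
    "HOL-Library.Poly_Mapping"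
begin

text \<open>
  The index type \<open>'n\<close> enumerates the \<open>N = CARD('n) \<ge> 1\<close> kinematic invariants, so a point of
  kinematic space is \<open>s :: real ^ 'n\<close>. An assignment \<open>{m\<^sub>j}\<close> is a finitely supported exponent
  function \<open>'n \<Rightarrow>\<^sub>0 nat\<close> of total degree \<open>j\<close>.

  At a fixed kinematic point, a truncated expansion is a polynomial in the formal variables
  \<open>\<lambda>\<^sub>n\<close> over the field of formal Laurent series in \<open>\<alpha>\<close>. Negative powers of \<open>\<alpha>\<close> are needed for
  the substitution of \<open>L\<^sub>R\<close>. Since the \<open>\<lambda>\<^sub>n\<close> are formal, the relation \<open>\<lambda>\<^sub>n = s\<^sub>n / M\<^sub>n\<^sup>2\<close> is not
  used; the dependence on \<open>s\<close> of the coefficients is kept.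
\<close>

type_synonym 'n assignment = "'n \<Rightarrow>\<^sub>0 nat"
type_synonym ('n, 'c) amplitude = "'n assignment \<Rightarrow>\<^sub>0 'c fls"

definition assignments :: "nat \<Rightarrow> ('n::finite) assignment set" where
  "assignments j = {m. (\<Sum>n\<in>UNIV. Poly_Mapping.lookup m n) = j}"

definition scalar :: "'c::field fls \<Rightarrow> ('n, 'c) amplitude" where
  "scalar f = Poly_Mapping.single 0 f"

definition lam :: "'n \<Rightarrow> ('n, 'c::field) amplitude" where
  "lam n = Poly_Mapping.single (Poly_Mapping.single n 1) 1"

definition lam_pow :: "('n::finite) assignment \<Rightarrow> ('n, 'c::field) amplitude" where
  "lam_pow m = (\<Prod>n\<in>UNIV. lam n ^ Poly_Mapping.lookup m n)"

definition alpha :: "'c::field fls" where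
  "alpha = fls_X"

definition A_loop ::
  "'c::field fls \<Rightarrow> (nat \<Rightarrow> nat \<Rightarrow> ('n::finite) assignment \<Rightarrow> 'c) \<Rightarrow> nat \<Rightarrow> ('n, 'c) amplitude" where
  "A_loop K A l = scalar K *
     (1 + (\<Sum>j\<in>{1..l}. \<Sum>m\<in>assignments j. scalar (fls_const (A 0 j m)) * lam_pow m)
        + (\<Sum>i\<in>{1..l}. \<Sum>j\<in>{1..l}. \<Sum>m\<in>assignments j.
             scalar (fls_const (A i j m) * alpha ^ i) * lam_pow m))"

text \<open>
  The difference \<open>i - l\<close> below is truncated at \<open>0\<close>, so the range of \<open>k\<close> is
  \<open>max 0 (i - l) \<le> k \<le> i\<close>. The argument \<open>L\<close> is the value substituted for \<open>L\<^sub>R\<close>.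
\<close>

definition B_loop ::
  "'c::field fls \<Rightarrow> (nat \<Rightarrow> nat \<Rightarrow> nat \<Rightarrow> ('n::finite) assignment \<Rightarrow> 'c) \<Rightarrow> nat \<Rightarrow> 'c fls
     \<Rightarrow> ('n, 'c) amplitude" where
  "B_loop K B l L = scalar K *
     (1 + (\<Sum>i\<in>{1..l + 1}. \<Sum>j\<in>{1..l}. \<Sum>k\<in>{i - l..i}. \<Sum>m\<in>assignments j.
             scalar (fls_const (B i j k m) * alpha ^ i * L ^ k) * lam_pow m))"

definition L_expansion :: "nat \<Rightarrow> (int \<Rightarrow> 'c::field) \<Rightarrow> 'c fls" where
  "L_expansion l X = (\<Sum>i\<in>{-1..int l - 1}. fls_const (X i) * fls_X_intpow i)"

text \<open>
  The coefficient of \<open>\<alpha>\<^sup>r \<lambda>\<^sup>m\<close> in \<open>P / K\<close>. It is only used for \<open>r \<le> l\<close>, which is how the powers of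
  \<open>\<alpha>\<close> above \<open>l\<close> are discarded.
\<close>

definition coeff_over :: "('n, 'c::field) amplitude \<Rightarrow> 'c fls \<Rightarrow> nat \<Rightarrow> 'n assignment \<Rightarrow> 'c" where
  "coeff_over P K r m = fls_nth (Poly_Mapping.lookup P m / K) (int r)"

text \<open>The partial derivative of \<open>f\<close> in the direction \<open>n\<close> exists at \<open>s\<close> and equals \<open>d\<close>.\<close>

definition has_partial_deriv ::
  "(real ^ 'n \<Rightarrow> 'c::real_normed_vector) \<Rightarrow> 'c \<Rightarrow> 'n::finite \<Rightarrow> real ^ 'n \<Rightarrow> bool" where
  "has_partial_deriv f d n s \<longleftrightarrow>
     ((\<lambda>t. f (s + t *\<^sub>R axis n 1)) has_vector_derivative d) (at 0)"

lemma finite_assignments: "finite (assignments j :: ('n::finite) assignment set)"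
proof (rule finite_imageD)
  show "inj_on Poly_Mapping.lookup (assignments j :: 'n assignment set)"
    by (meson inj_onI lookup_inject)
  have "Poly_Mapping.lookup ` (assignments j :: 'n assignment set)
          \<subseteq> Pi\<^sub>E UNIV (\<lambda>_. {..j})"
    by (auto simp: assignments_def intro!: member_le_sum)
  then show "finite (Poly_Mapping.lookup ` (assignments j :: 'n assignment set))"
    by (rule finite_subset) (auto intro: finite_PiE)
qed

lemma lam_pow_eq_single:
  "(lam_pow m :: ('n::finite, 'c::field) amplitude) = Poly_Mapping.single m 1"
proof -
  have pow: "(lam n :: ('n, 'c) amplitude) ^ k
      = Poly_Mapping.single (Poly_Mapping.single n k) 1" for n k
    by (induction k) (simp_all add: lam_def mult_single flip: single_add)
  have "(\<Prod>n\<in>S. (lam n :: ('n, 'c) amplitude) ^ Poly_Mapping.lookup m n)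
      = Poly_Mapping.single (\<Sum>n\<in>S. Poly_Mapping.single n (Poly_Mapping.lookup m n)) 1"
    if "finite S" for S
    using that by induction (simp_all add: pow mult_single)
  moreover have "(\<Sum>n\<in>UNIV. Poly_Mapping.single n (Poly_Mapping.lookup m n)) = m"
    by (rule poly_mapping_eqI) (simp add: lookup_sum lookup_single when_def)
  ultimately show ?thesis
    by (simp add: lam_pow_def)
qed

end

theory Submission
  imports Defs
begin

text \<open>
  Writing \<open>L\<^sub>R = P / \<alpha>\<close> with a power series \<open>P\<close>, every term \<open>\<alpha>\<^sup>i L\<^sub>R\<^sup>k\<close> is a shift of \<open>P\<^sup>k\<close>, so each coefficient
  of \<open>B\<close> is a finite sum of coefficients of \<open>P\<close>, \<open>P\<^sup>2\<close> and \<open>P\<^sup>3\<close>. On the analytic side, a function with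
  vanishing partial derivatives is constant on every ball (change one coordinate at a time), hence
  locally constant, hence constant on a connected open set.
\<close>

section \<open>Functions with vanishing partial derivatives\<close>

text \<open>As \<open>D\<close> is open, the line through \<open>s\<close> stays in \<open>D\<close>
  for small parameters, where \<open>f\<close> agrees with a constant.\<close>

lemma constant_on_imp_has_partial_deriv_0:
  fixes f :: "real ^ 'n::finite \<Rightarrow> 'c::real_normed_vector"
  assumes "f constant_on D" "open D" "s \<in> D"
  shows "has_partial_deriv f 0 n s"
proof -
  obtain c where c: "\<And>x. x \<in> D \<Longrightarrow> f x = c"
    using assms(1) by (auto simp: constant_on_def)
  let ?g = "\<lambda>t::real. s + t *\<^sub>R axis n 1"
  have "open (?g -` D)"
    by (intro open_vimage continuous_intros assms)
  moreover have "((\<lambda>t. c) has_vector_derivative 0) (at (0::real))"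
    by (rule has_vector_derivative_const)
  ultimately show ?thesis
    unfolding has_partial_deriv_def
    using assms(3) by (elim has_vector_derivative_transform_within_open) (auto simp: c)
qed

text \<open>Convexity keeps the whole segment in \<open>C\<close>, so \<open>f\<close> along it is a
  function of one real variable with zero derivative.\<close>

lemma zero_partial_deriv_imp_eq_on_line:
  fixes f :: "real ^ 'n::finite \<Rightarrow> 'c::real_normed_vector"
  assumes "convex C" "\<And>x. x \<in> C \<Longrightarrow> has_partial_deriv f 0 n x"
    and "x \<in> C" "x + t *\<^sub>R axis n 1 \<in> C"
  shows "f (x + t *\<^sub>R axis n 1) = f x"
proof -
  let ?g = "\<lambda>t::real. x + t *\<^sub>R axis n 1"
  let ?T = "closed_segment 0 t"
  have "((\<lambda>u. f (?g u)) has_derivative (\<lambda>h. 0)) (at u within ?T)" if u: "u \<in> ?T" for u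
  proof -
    have "?g u \<in> closed_segment x (x + t *\<^sub>R axis n 1)"
      using u by (auto simp: in_segment algebra_simps)
    then have "?g u \<in> C"
      using assms(1,3,4) closed_segment_subset by blast
    then have "((\<lambda>v. f (?g u + v *\<^sub>R axis n 1)) has_vector_derivative 0) (at 0)"
      using assms(2) by (simp add: has_partial_deriv_def)
    \<comment> \<open>\<open>has_partial_deriv\<close> puts the derivative at parameter 0 of a line
      based at \<open>?g u\<close>; composing with \<open>v - u\<close> moves it to parameter
      \<open>u\<close> of the fixed line.\<close>
    then have "((\<lambda>v. f (?g (u + v))) has_vector_derivative 0) (at (u - u))"
      by (simp add: algebra_simps)
    moreover have "((\<lambda>v. v - u) has_vector_derivative 1) (at u)"
      by (auto intro!: derivative_eq_intros)
    ultimately have "((\<lambda>v. f (?g (u + v))) \<circ> (\<lambda>v. v - u) has_vector_derivative 1 *\<^sub>R 0) (at u)"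
      by (intro vector_diff_chain_at)
    then have "((\<lambda>v. f (?g v)) has_derivative (\<lambda>h. 0)) (at u)"
      by (simp add: has_vector_derivative_def o_def)
    then show ?thesis
      by (rule has_derivative_at_withinI)
  qed
  then have "f (?g t) = f (?g 0)"
    by (intro has_derivative_zero_unique[where s = ?T and f = "\<lambda>u. f (?g u)"]) auto
  then show ?thesis
    by simp
qed

lemma zero_partial_derivs_imp_eq_on_ball:
  fixes f :: "real ^ 'n::finite \<Rightarrow> 'c::real_normed_vector"
  assumes "\<And>n z. z \<in> ball x e \<Longrightarrow> has_partial_deriv f 0 n z" and y: "y \<in> ball x e"
  shows "f y = f x"
proof -
  \<comment> \<open>A hybrid point: coordinates of \<open>y\<close> on \<open>S\<close>, of
    \<open>x\<close> elsewhere. It runs from \<open>x\<close> at \<open>{}\<close> to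
    \<open>y\<close> at \<open>UNIV\<close>, and each insertion moves it parallel to one
    axis.\<close>
  define p where "p S = (\<chi> i. if i \<in> S then y $ i else x $ i)" for S
  have p_ball: "p S \<in> ball x e" for S
  proof -
    \<comment> \<open>Each coordinate of \<open>x - p S\<close> is 0 or that of
      \<open>x - y\<close>, so no hybrid point leaves the ball.\<close>
    have "norm (x - p S) \<le> norm (x - y)"
      by (rule norm_le_componentwise_cart) (simp add: p_def)
    then show ?thesis
      using y by (simp add: dist_norm)
  qed
  have "f (p S) = f (p {})" if "finite S" for S
    using that
  proof induction
    case (insert n S)
    have "p (insert n S) = p S + (y $ n - x $ n) *\<^sub>R axis n 1"
      using insert.hyps by (auto simp: p_def vec_eq_iff axis_def)
    then have "f (p (insert n S)) = f (p S)"
      using zero_partial_deriv_imp_eq_on_line[OF convex_ball, of x e f n "p S" "y $ n - x $ n"]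
        assms(1) p_ball p_ball[of "insert n S"] by simp
    with insert.IH show ?case
      by simp
  qed simp
  from this[of UNIV] show ?thesis
    by (simp add: p_def)
qed

lemma constant_on_iff_zero_partial_derivs:
  fixes f :: "real ^ 'n::finite \<Rightarrow> 'c::real_normed_vector"
  assumes "open D" "connected D"
  shows "f constant_on D \<longleftrightarrow> (\<forall>n. \<forall>s\<in>D. has_partial_deriv f 0 n s)"
proof
  assume deriv: "\<forall>n. \<forall>s\<in>D. has_partial_deriv f 0 n s"
  have "\<forall>\<^sub>F b in at a within D. f a = f b" if "a \<in> D" for a
  proof -
    obtain e where "e > 0" "ball a e \<subseteq> D"
      using assms(1) \<open>a \<in> D\<close> by (meson open_contains_ball)
    then have "f a = f b" if "b \<in> ball a e" for b
      using that deriv by (intro zero_partial_derivs_imp_eq_on_ball[symmetric, of a e]) auto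
    then show ?thesis
      using eventually_at_ball[OF \<open>e > 0\<close>, of a D] by (auto elim!: eventually_mono)
  qed
  then have "f a = f b" if "a \<in> D" "b \<in> D" for a b
    using connected_local_const[OF assms(2) that] by blast
  then show "f constant_on D"
    unfolding constant_on_def by metis
qed (use assms in \<open>blast intro: constant_on_imp_has_partial_deriv_0\<close>)

section \<open>Coefficients of the truncated expansions\<close>

lemma lookup_scalar_mult:
  "Poly_Mapping.lookup (scalar f * P) m = f * Poly_Mapping.lookup P m"
proof -
  have "scalar f * P = Poly_Mapping.map ((*) f) P"
    unfolding scalar_def by (rule mult_map_scale_conv_mult[symmetric])
  then show ?thesis
    by (simp add: Poly_Mapping.map.rep_eq when_def)
qed

lemma lookup_scalar_lam_pow:
  "Poly_Mapping.lookup (scalar f * lam_pow m' :: ('n::finite, 'c::field) amplitude) m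
     = (if m' = m then f else 0)"
  by (simp add: lookup_scalar_mult lam_pow_eq_single lookup_single when_def)

text \<open>The total degree of \<open>m\<close> determines \<open>j\<close>; this collapses the
  sums over \<open>j\<close> in both truncated expansions to one term.\<close>

lemma assignments_unique: "m \<in> assignments j \<Longrightarrow> m \<in> assignments j' \<longleftrightarrow> j' = j"
  by (auto simp: assignments_def)

lemma lookup_one_assignments:
  assumes "m \<in> assignments j" "j \<ge> 1"
  shows "Poly_Mapping.lookup (1 :: ('n::finite, 'c::field) amplitude) m = 0"
proof -
  have "m \<noteq> 0"
    using assms by (auto simp: assignments_def)
  then show ?thesis
    by (simp add: lookup_one when_def)
qed

text \<open>Once \<open>K\<close> cancels, the first sum supplies \<open>r = 0\<close> and the
  second \<open>1 \<le> r\<close>; the bound \<open>r \<le> l\<close> keeps \<open>r\<close> inside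
  the truncation.\<close>

lemma coeff_over_A_loop:
  assumes "K \<noteq> 0" "m \<in> assignments j" "j \<in> {1..l}" "r \<le> l"
  shows "coeff_over (A_loop K A l) K r m = A r j m"
proof -
  have "Poly_Mapping.lookup (A_loop K A l) m / K
      = fls_const (A 0 j m) + (\<Sum>i\<in>{1..l}. fls_const (A i j m) * fls_X ^ i)"
    using assms(1,3) unfolding A_loop_def lookup_scalar_mult[of K]
    by (simp add: lookup_add lookup_sum lookup_scalar_lam_pow finite_assignments
      assignments_unique[OF assms(2)] lookup_one_assignments[OF assms(2)] alpha_def)
  then have "coeff_over (A_loop K A l) K r m
      = (if r = 0 then A 0 j m else 0) + (\<Sum>i\<in>{1..l}. if r = i then A i j m else 0)"
    by (simp add: coeff_over_def fls_nth_sum if_distrib cong: if_cong)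
  also have "\<dots> = A r j m"
    using assms(4) by (cases r) auto
  finally show ?thesis .
qed

lemma coeff_over_B_loop:
  assumes "K \<noteq> 0" "m \<in> assignments j" "j \<in> {1..l}"
  shows "coeff_over (B_loop K B l L) K r m
    = (\<Sum>i\<in>{1..l + 1}. \<Sum>k\<in>{i - l..i}. B i j k m * fls_nth (alpha ^ i * L ^ k) (int r))"
proof -
  have "Poly_Mapping.lookup (B_loop K B l L) m / K
      = (\<Sum>i\<in>{1..l + 1}. \<Sum>j'\<in>{1..l}. \<Sum>k\<in>{i - l..i}.
           if j' = j then fls_const (B i j k m) * (alpha ^ i * L ^ k) else 0)"
    using assms(1,3) unfolding B_loop_def lookup_scalar_mult[of K]
    by (simp add: lookup_add lookup_sum lookup_scalar_lam_pow finite_assignments mult.assoc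
      assignments_unique[OF assms(2)] lookup_one_assignments[OF assms(2)]
      if_distrib cong: if_cong del: sum.cl_ivl_Suc)
  \<comment> \<open>The range of \<open>k\<close> does not depend on \<open>j'\<close>, so the sum
    over \<open>j'\<close> can go innermost, where the condition \<open>j' = j\<close> selects a
    single term.\<close>
  also have "\<dots> = (\<Sum>i\<in>{1..l + 1}. \<Sum>k\<in>{i - l..i}. \<Sum>j'\<in>{1..l}.
           if j' = j then fls_const (B i j k m) * (alpha ^ i * L ^ k) else 0)"
    by (rule sum.cong[OF refl sum.swap])
  also have "\<dots> = (\<Sum>i\<in>{1..l + 1}. \<Sum>k\<in>{i - l..i}. fls_const (B i j k m) * (alpha ^ i * L ^ k))"
    using assms(3) by (simp del: sum.cl_ivl_Suc)
  finally show ?thesis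
    by (simp add: coeff_over_def fls_nth_sum del: sum.cl_ivl_Suc)
qed

text \<open>This is the power series P, that is \<alpha> times the expansion of the logarithm. The
  expansion starts at exponent -1, hence the offset between \<open>n\<close> and the index of
  \<open>X\<close>.\<close>

definition L_series :: "nat \<Rightarrow> (int \<Rightarrow> 'c::field) \<Rightarrow> 'c fps" where
  "L_series l X = Abs_fps (\<lambda>n. if n \<le> l then X (int n - 1) else 0)"

lemma L_expansion_conv_shift: "L_expansion l X = fls_shift 1 (fps_to_fls (L_series l X))"
proof (rule fls_eqI)
  fix n :: int
  have "fls_nth (L_expansion l X) n = (\<Sum>i\<in>{-1..int l - 1}. if n = i then X i else 0)"
    by (simp add: L_expansion_def fls_nth_sum if_distrib cong: if_cong)
  then show "fls_nth (L_expansion l X) n = fls_nth (fls_shift 1 (fps_to_fls (L_series l X))) n"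
    by (auto simp: L_series_def)
qed

text \<open>The product is P^k shifted by i - k, so exponent \<open>r\<close> corresponds to index
  \<open>r + k - i\<close> of P^k. The first branch catches negative indices, which truncated
  subtraction would send to 0.\<close>

lemma nth_alpha_power_times_L_expansion_power:
  "fls_nth (alpha ^ i * L_expansion l X ^ k) (int r)
    = (if r + k < i then 0 else fps_nth (L_series l X ^ k) (r + k - i))"
proof -
  have "alpha ^ i * L_expansion l X ^ k
      = fls_shift (int k - int i) (fps_to_fls (L_series l X ^ k))"
    by (simp add: L_expansion_conv_shift alpha_def fls_X_power_times_conv_shift fls_shifted_pow
      fps_to_fls_power)
  then show ?thesis
    by (auto simp: nat_diff_distrib nat_add_distrib intro!: arg_cong[of _ _ "fps_nth _"])
qed

lemma L_series_nth [simp]: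
  "fps_nth (L_series l X) n = (if n \<le> l then X (int n - 1) else 0)"
  by (simp add: L_series_def)

theorem mainTheorem1:
  fixes D :: "(real ^ 'n::finite) set"
    and K :: "'c::real_normed_field fls"
    and A :: "real ^ 'n \<Rightarrow> nat \<Rightarrow> nat \<Rightarrow> 'n assignment \<Rightarrow> 'c"
    and B :: "real ^ 'n \<Rightarrow> nat \<Rightarrow> nat \<Rightarrow> nat \<Rightarrow> 'n assignment \<Rightarrow> 'c"
    and X :: "int \<Rightarrow> real ^ 'n \<Rightarrow> 'c"
    and l :: nat
  assumes "l \<in> {1, 2}"
    and "open D" and "connected D"
    and "K \<noteq> 0"
  shows
    "((\<forall>s\<in>D. \<forall>r\<in>{0..l}. \<forall>j\<in>{1..l}. \<forall>m\<in>assignments j.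
         coeff_over (B_loop K (B s) l (L_expansion l (\<lambda>i. X i s))) K r m
           = coeff_over (A_loop K (A s) l) K r m)
      \<and> (\<forall>i\<in>{-1..int l - 1}. X i constant_on D))
     \<longleftrightarrow>
     ((\<forall>i\<in>{-1..int l - 1}. \<forall>n. \<forall>s\<in>D. has_partial_deriv (X i) 0 n s)
      \<and> (l = 1 \<longrightarrow> (\<forall>s\<in>D. \<forall>m\<in>assignments 1.
           A s 0 1 m - B s 1 1 1 m * X (-1) s - B s 2 1 2 m * (X (-1) s)^2 = 0
         \<and> A s 1 1 m - B s 1 1 0 m - B s 1 1 1 m * X 0 s - B s 2 1 1 m * X (-1) s
             - 2 * B s 2 1 2 m * X (-1) s * X 0 s = 0))
      \<and> (l = 2 \<longrightarrow> (\<forall>s\<in>D. \<forall>j\<in>{1, 2}. \<forall>m\<in>assignments j.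
           A s 0 j m - B s 1 j 1 m * X (-1) s - B s 2 j 2 m * (X (-1) s)^2
             - B s 3 j 3 m * (X (-1) s)^3 = 0
         \<and> A s 1 j m - B s 1 j 0 m - B s 1 j 1 m * X 0 s - B s 2 j 1 m * X (-1) s
             - 2 * B s 2 j 2 m * X (-1) s * X 0 s - B s 3 j 2 m * (X (-1) s)^2
             - 3 * B s 3 j 3 m * (X (-1) s)^2 * X 0 s = 0
         \<and> A s 2 j m - B s 2 j 0 m - B s 1 j 1 m * X 1 s - B s 2 j 1 m * X 0 s
             - B s 2 j 2 m * ((X 0 s)^2 + 2 * X (-1) s * X 1 s)
             - B s 3 j 1 m * X (-1) s - 2 * B s 3 j 2 m * X (-1) s * X 0 s
             - 3 * B s 3 j 3 m * (X (-1) s * (X 0 s)^2 + (X (-1) s)^2 * X 1 s) = 0)))"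
proof -
  have constant_iff: "(\<forall>i\<in>{-1..int l - 1}. X i constant_on D)
      \<longleftrightarrow> (\<forall>i\<in>{-1..int l - 1}. \<forall>n. \<forall>s\<in>D. has_partial_deriv (X i) 0 n s)"
    using constant_on_iff_zero_partial_derivs[OF assms(2,3)] by blast
  \<comment> \<open>The left-hand sides of all the matching equations in one formula, A-coefficient
    minus B-coefficient.\<close>
  define E where "E s r j m = A s r j m - (\<Sum>i\<in>{1..l + 1}. \<Sum>k\<in>{i - l..i}. B s i j k m *
      (if r + k < i then 0 else fps_nth (L_series l (\<lambda>i. X i s) ^ k) (r + k - i)))" for s r j m
  have coeffs: "coeff_over (B_loop K (B s) l (L_expansion l (\<lambda>i. X i s))) K r m
        = coeff_over (A_loop K (A s) l) K r m \<longleftrightarrow> E s r j m = 0"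
    if "j \<in> {1..l}" "m \<in> assignments j" "r \<in> {0..l}" for s r j m
    unfolding E_def
      coeff_over_A_loop[OF assms(4) that(2,1) that(3)[unfolded atLeastAtMost_iff, THEN conjunct2]]
      coeff_over_B_loop[OF assms(4) that(2,1)] nth_alpha_power_times_L_expansion_power
    by (rule trans[OF eq_commute eq_iff_diff_eq_0])
  \<comment> \<open>Moving \<open>r\<close> innermost lets its finite range unfold into the
    conjunction of equations for each assignment.\<close>
  have agree_iff: "(\<forall>s\<in>D. \<forall>r\<in>{0..l}. \<forall>j\<in>{1..l}. \<forall>m\<in>assignments j.
         coeff_over (B_loop K (B s) l (L_expansion l (\<lambda>i. X i s))) K r m
           = coeff_over (A_loop K (A s) l) K r m)
      \<longleftrightarrow> (\<forall>s\<in>D. \<forall>j\<in>{1..l}. \<forall>m\<in>assignments j. \<forall>r\<in>{0..l}. E s r j m = 0)"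
    using coeffs by blast
  from assms(1) consider "l = 1" | "l = 2" by auto
  then show ?thesis
  proof cases
    case 1
    \<comment> \<open>The pairs (i, k) are (1,0), (1,1), (2,1), (2,2), so P^2 is the highest power
      to expand.\<close>
    have E0: "E s 0 j m = A s 0 j m - B s 1 j 1 m * X (-1) s - B s 2 j 2 m * (X (-1) s)^2"
      and E1: "E s 1 j m = A s 1 j m - B s 1 j 0 m - B s 1 j 1 m * X 0 s - B s 2 j 1 m * X (-1) s
             - 2 * B s 2 j 2 m * X (-1) s * X 0 s" for s j m
      using 1 by (simp_all add: E_def numeral_2_eq_2 fps_mult_nth algebra_simps)
    have ranges: "{0..l} = {0, 1}" "{1..l} = {1}"
      using 1 by auto
    have agree_iff': "(\<forall>s\<in>D. \<forall>j\<in>{1..l}. \<forall>m\<in>assignments j. \<forall>r\<in>{0..l}. E s r j m = 0)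
        \<longleftrightarrow> (\<forall>s\<in>D. \<forall>m\<in>assignments 1. E s 0 1 m = 0 \<and> E s 1 1 m = 0)"
      unfolding ranges by simp
    \<comment> \<open>The conjunct guarded by \<open>l = 2\<close> becomes vacuous, as 1 and 2
      differ.\<close>
    show ?thesis
      unfolding agree_iff constant_iff agree_iff' E0 E1
      by (simp only: 1 simp_thms one_eq_numeral_iff num.distinct conj_commute)
  next
    case 2
    \<comment> \<open>Now k runs over 0..1, 0..2 and 1..3 for i = 1, 2, 3. The factors 2 and 3 come
      from the convolutions for P^2 and P^3.\<close>
    have E0: "E s 0 j m = A s 0 j m - B s 1 j 1 m * X (-1) s - B s 2 j 2 m * (X (-1) s)^2
             - B s 3 j 3 m * (X (-1) s)^3"
      and E1: "E s 1 j m = A s 1 j m - B s 1 j 0 m - B s 1 j 1 m * X 0 s - B s 2 j 1 m * X (-1) s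
             - 2 * B s 2 j 2 m * X (-1) s * X 0 s - B s 3 j 2 m * (X (-1) s)^2
             - 3 * B s 3 j 3 m * (X (-1) s)^2 * X 0 s"
      and E2: "E s 2 j m = A s 2 j m - B s 2 j 0 m - B s 1 j 1 m * X 1 s - B s 2 j 1 m * X 0 s
             - B s 2 j 2 m * ((X 0 s)^2 + 2 * X (-1) s * X 1 s)
             - B s 3 j 1 m * X (-1) s - 2 * B s 3 j 2 m * X (-1) s * X 0 s
             - 3 * B s 3 j 3 m * (X (-1) s * (X 0 s)^2 + (X (-1) s)^2 * X 1 s)" for s j m
      using 2 by (simp_all add: E_def numeral_2_eq_2 numeral_3_eq_3 fps_mult_nth algebra_simps)
    have ranges: "{0..l} = {0, 1, 2}" "{1..l} = {1, 2}"
      using 2 by auto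
    have agree_iff': "(\<forall>s\<in>D. \<forall>j\<in>{1..l}. \<forall>m\<in>assignments j. \<forall>r\<in>{0..l}. E s r j m = 0)
        \<longleftrightarrow> (\<forall>s\<in>D. \<forall>j\<in>{1, 2}. \<forall>m\<in>assignments j. E s 0 j m = 0 \<and> E s 1 j m = 0 \<and> E s 2 j m = 0)"
      unfolding ranges by simp
    show ?thesis
      unfolding agree_iff constant_iff agree_iff' E0 E1 E2
      by (simp only: 2 simp_thms numeral_eq_one_iff num.distinct conj_commute)
  qed
qed

end
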